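(* Let $X_1,\dots,X_n$ be a random sample from a univariate continuous distribution, let $R_1,\dots,R_n$ be the (classical univariate) ranks of $|X_1|,\dots,|X_n|$, and let $\mathbf{F}_{\pm,a}^{(n)}$ and $S_{\pm,a}$ denote the empirical center-outward distribution function and signs computed from the symmetrized sample $\{X_1,\dots,X_n,-X_1,\dots,-X_n\}$. Put $$T_{S,a}=\frac1{\sqrt n}\sum_{i=1}^nS_{\pm,a}(X_i),\qquad T_{F,a}=\frac1{\sqrt n}\sum_{i=1}^n\mathbf{F}_{\pm,a}^{(n)}(X_i).$$ Let $W_S=\sum_{i=1}^n\mathrm{I}[X_i>0]$ be the statistic of the univariate sign test and $W_W=\sum_{i:X_i>0}R_i$ the statistic of the one-sample Wilcoxon test. Then, almost surely, $$\sqrt n\,T_{S,a}=2W_S-n\qquad\text{and}\qquad \sqrt n\,T_{F,a}=\frac{2W_W-\frac{n(n+1)}{2}}{n+1}.$$ Thus for $d=1$ the test based on $T_{S,a}$ is the univariate sign test and the test based on $T_{F,a}$ is equivalent to the one-sample Wilcoxon test.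
   Context: $\mathrm{I}[\cdot]$ is the indicator. The rank of $|X_i|$ is $R_i=\#\{j:|X_j|\le|X_i|\}$. In dimension $d=1$ with $2n$ points, the grid is $\mathcal{G}_{2n}=\{\pm k/(n+1):k=1,\dots,n\}$. $\mathbf{F}_{\pm,a}^{(n)}$ is the one-to-one assignment $g$ of the $2n$ points $X_1,\dots,X_n,-X_1,\dots,-X_n$ to the $2n$ points of $\mathcal{G}_{2n}$ minimizing $\sum_{i=1}^n|X_i-g(X_i)|^2+\sum_{i=1}^n|-X_i-g(-X_i)|^2$. The center-outward sign is $S_{\pm,a}(x)=\mathbf{F}_{\pm,a}^{(n)}(x)/|\mathbf{F}_{\pm,a}^{(n)}(x)|$. Equivalence of tests is meant in the sense of the two displayed identities: each statistic is a strictly increasing affine function of the corresponding classical statistic. *)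

theory Defs
  imports "HOL-Probability.Probability"
begin

text \<open>A sample \<open>x\<^sub>1, \<dots>, x\<^sub>n\<close> is a function \<open>x :: nat \<Rightarrow> real\<close> of which only the values at
  \<open>{1..n}\<close> matter. A distribution is continuous when its distribution function is (a density
  is not required).\<close>

definition continuous_random_sample ::
    "'a measure \<Rightarrow> nat \<Rightarrow> (nat \<Rightarrow> 'a \<Rightarrow> real) \<Rightarrow> bool" where
  "continuous_random_sample M n X \<longleftrightarrow>
     prob_space M \<and>
     prob_space.indep_vars M (\<lambda>_. borel) X {1..n} \<and>
     (\<exists>D. (\<forall>i\<in>{1..n}. distr M borel (X i) = D) \<and> continuous_on UNIV (cdf D))"

definition abs_rank :: "nat \<Rightarrow> (nat \<Rightarrow> real) \<Rightarrow> nat \<Rightarrow> nat" where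
  "abs_rank n x i = card {j\<in>{1..n}. \<bar>x j\<bar> \<le> \<bar>x i\<bar>}"

definition grid :: "nat \<Rightarrow> real set" where
  "grid n = (\<lambda>k. real k / (real n + 1)) ` {1..n} \<union> (\<lambda>k. - (real k / (real n + 1))) ` {1..n}"

definition symmetrized :: "nat \<Rightarrow> (nat \<Rightarrow> real) \<Rightarrow> real set" where
  "symmetrized n x = x ` {1..n} \<union> (\<lambda>i. - x i) ` {1..n}"

text \<open>Assignments are made extensional so that a minimizer can be unique as a function.\<close>

definition assignments :: "nat \<Rightarrow> (nat \<Rightarrow> real) \<Rightarrow> (real \<Rightarrow> real) set" where
  "assignments n x =
     {g \<in> extensional (symmetrized n x). bij_betw g (symmetrized n x) (grid n)}"

definition assignment_cost :: "nat \<Rightarrow> (nat \<Rightarrow> real) \<Rightarrow> (real \<Rightarrow> real) \<Rightarrow> real" where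
  "assignment_cost n x g =
     (\<Sum>i=1..n. \<bar>x i - g (x i)\<bar>\<^sup>2) + (\<Sum>i=1..n. \<bar>- x i - g (- x i)\<bar>\<^sup>2)"

text \<open>The value is unspecified on samples for which there is no unique optimal assignment, e.g.
  when the symmetrized sample does not consist of \<open>2 n\<close> distinct points.\<close>

definition center_outward :: "nat \<Rightarrow> (nat \<Rightarrow> real) \<Rightarrow> real \<Rightarrow> real" where
  "center_outward n x =
     (THE g. is_arg_min (assignment_cost n x) (\<lambda>g. g \<in> assignments n x) g)"

definition center_outward_sign :: "nat \<Rightarrow> (nat \<Rightarrow> real) \<Rightarrow> real \<Rightarrow> real" where
  "center_outward_sign n x y = center_outward n x y / \<bar>center_outward n x y\<bar>"

definition T_S :: "nat \<Rightarrow> (nat \<Rightarrow> real) \<Rightarrow> real" where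
  "T_S n x = 1 / sqrt (real n) * (\<Sum>i=1..n. center_outward_sign n x (x i))"

definition T_F :: "nat \<Rightarrow> (nat \<Rightarrow> real) \<Rightarrow> real" where
  "T_F n x = 1 / sqrt (real n) * (\<Sum>i=1..n. center_outward n x (x i))"

definition W_sign :: "nat \<Rightarrow> (nat \<Rightarrow> real) \<Rightarrow> real" where
  "W_sign n x = (\<Sum>i=1..n. indicator {0<..} (x i))"

definition W_Wilcoxon :: "nat \<Rightarrow> (nat \<Rightarrow> real) \<Rightarrow> real" where
  "W_Wilcoxon n x = (\<Sum>i | i \<in> {1..n} \<and> x i > 0. real (abs_rank n x i))"

definition increasing_affine :: "(real \<Rightarrow> real) \<Rightarrow> bool" where
  "increasing_affine \<phi> \<longleftrightarrow> strict_mono \<phi> \<and> (\<exists>a b. \<forall>t. \<phi> t = a * t + b)"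

text \<open>The transformation \<open>\<phi>\<close> depends on the sample size only, not on the underlying distribution:
  this is what makes the tests based on the two statistics the same. The type argument fixes
  the type of the sample space.\<close>

definition equivalent_test_statistics ::
    "'a itself \<Rightarrow> nat \<Rightarrow> ((nat \<Rightarrow> real) \<Rightarrow> real) \<Rightarrow> ((nat \<Rightarrow> real) \<Rightarrow> real) \<Rightarrow> bool" where
  "equivalent_test_statistics _ n T W \<longleftrightarrow>
     (\<exists>\<phi>. increasing_affine \<phi> \<and>
       (\<forall>(M :: 'a measure) X. continuous_random_sample M n X \<longrightarrow>
          (AE \<omega> in M. T (\<lambda>i. X i \<omega>) = \<phi> (W (\<lambda>i. X i \<omega>)))))"

end

theory Submission
  imports Defs
begin

text \<open>
  Expanding the squares, the cost of an assignment \<open>g\<close> of a finite set of reals onto another is a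
  constant minus \<open>2 \<Sum> a * g a\<close>. Exchanging the images of two points that \<open>g\<close> puts in the wrong
  order therefore lowers the cost (\<open>swap_lowers_cost\<close>), so an optimal assignment is strictly
  increasing, and there is only one increasing assignment between two finite sets of reals
  (\<open>strict_mono_bij_unique\<close>).

  Suppose that the \<open>\<bar>x\<^sub>i\<bar>\<close> are distinct and nonzero. Then the map \<open>signed_rank\<close>, which sends a
  point \<open>y\<close> of the symmetrized sample to \<open>sgn y\<close> times the rank of \<open>\<bar>y\<bar>\<close> divided by \<open>n + 1\<close>, is
  strictly increasing and onto the grid, so it is the center-outward distribution function
  (\<open>center_outward_eq_signed_rank\<close>). The center-outward signs are thus the ordinary signs, and
  both identities reduce to the fact that a sum with weights \<open>\<plusminus>1\<close> is twice its positively
  weighted part minus the unweighted sum; for the second one, the ranks sum to \<open>n (n + 1) / 2\<close>.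

  A sample from a continuous distribution is almost surely of this kind: the common distribution
  has no atoms, so \<open>X\<^sub>i \<noteq> 0\<close> almost surely, and by independence and Fubini \<open>X\<^sub>j \<notin> {X\<^sub>i, - X\<^sub>i}\<close>
  almost surely (\<open>AE_generic\<close>). The identities hold for every generic sample and their
  coefficients depend on \<open>n\<close> only, so solving them for the statistics gives one affine map for
  all underlying distributions.
\<close>

section \<open>Optimal assignments on the line\<close>

lemma card_filter_le_strict_mono:
  fixes f :: "'i \<Rightarrow> real"
  assumes "finite I" "i \<in> I" "u < f i"
  shows "card {j \<in> I. f j \<le> u} < card {j \<in> I. f j \<le> f i}"
proof (rule psubset_card_mono)
  have "i \<in> {j \<in> I. f j \<le> f i} - {j \<in> I. f j \<le> u}" using assms by simp
  moreover have "{j \<in> I. f j \<le> u} \<subseteq> {j \<in> I. f j \<le> f i}" using assms by auto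
  ultimately show "{j \<in> I. f j \<le> u} \<subset> {j \<in> I. f j \<le> f i}" by blast
qed (use assms in simp)

lemma strict_mono_bij_unique:
  fixes f g :: "real \<Rightarrow> real"
  assumes "finite A"
    and "strict_mono_on A f" "bij_betw f A B" and "strict_mono_on A g" "bij_betw g A B"
    and "a \<in> A"
  shows "f a = g a"
proof -
  \<comment> \<open>An increasing bijection preserves the number of points below, and that number identifies
    a point of \<open>B\<close>.\<close>
  have below: "card {b \<in> B. b \<le> h a} = card {c \<in> A. c \<le> a}"
    if h: "strict_mono_on A h" "bij_betw h A B" for h :: "real \<Rightarrow> real"
  proof -
    have "{b \<in> B. b \<le> h a} = h ` {c \<in> A. c \<le> a}"
      using h \<open>a \<in> A\<close> by (auto simp: bij_betw_def strict_mono_on_less_eq)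
    moreover have "inj_on h {c \<in> A. c \<le> a}"
      using h(2) by (auto simp: bij_betw_def intro: inj_on_subset)
    ultimately show ?thesis by (simp add: card_image)
  qed
  have finB: "finite B" using assms(1,3) bij_betw_finite by blast
  have lt: "card {b \<in> B. b \<le> u} < card {b \<in> B. b \<le> v}" if "u < v" "v \<in> B" for u v
    using card_filter_le_strict_mono[of B v u "\<lambda>b. b"] that finB by simp
  have "f a \<in> B" "g a \<in> B" using assms by (auto simp: bij_betw_def)
  moreover have "card {b \<in> B. b \<le> f a} = card {b \<in> B. b \<le> g a}"
    using below assms by simp
  ultimately show ?thesis using lt[of "f a" "g a"] lt[of "g a" "f a"] by linarith
qed

lemma swap_lowers_cost:
  fixes g :: "real \<Rightarrow> real"
  assumes "finite A" "a \<in> A" "b \<in> A" "a < b" "g b < g a"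
  shows "(\<Sum>c\<in>A. \<bar>c - (g(a := g b, b := g a)) c\<bar>\<^sup>2) < (\<Sum>c\<in>A. \<bar>c - g c\<bar>\<^sup>2)"
proof -
  have split: "(\<Sum>c\<in>A. F c) = F a + F b + (\<Sum>c\<in>A - {a, b}. F c)" for F :: "real \<Rightarrow> real"
    using sum.subset_diff[of "{a, b}" A F] assms by simp
  have rest: "(\<Sum>c\<in>A - {a, b}. \<bar>c - (g(a := g b, b := g a)) c\<bar>\<^sup>2)
      = (\<Sum>c\<in>A - {a, b}. \<bar>c - g c\<bar>\<^sup>2)"
    by (intro sum.cong) auto
  have "0 < (b - a) * (g a - g b)" using assms by simp
  then have "(a - g b)\<^sup>2 + (b - g a)\<^sup>2 < (a - g a)\<^sup>2 + (b - g b)\<^sup>2"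
    by (simp add: power2_eq_square algebra_simps)
  then show ?thesis unfolding split[of "\<lambda>c. \<bar>c - (g(a := g b, b := g a)) c\<bar>\<^sup>2"]
      split[of "\<lambda>c. \<bar>c - g c\<bar>\<^sup>2"] rest
    using assms by simp
qed

text \<open>There are finitely many assignments, so some assignment is optimal; the exchange argument
  identifies each optimal one with the given increasing assignment.\<close>

lemma is_arg_min_squared_distance_iff:
  fixes h :: "real \<Rightarrow> real"
  assumes "finite A" and h: "strict_mono_on A h" "bij_betw h A B" "h \<in> extensional A"
  shows "is_arg_min (\<lambda>g. \<Sum>a\<in>A. \<bar>a - g a\<bar>\<^sup>2) (\<lambda>g. g \<in> {g \<in> extensional A. bij_betw g A B}) g
    \<longleftrightarrow> g = h"
proof -
  let ?c = "\<lambda>g. \<Sum>a\<in>A. \<bar>a - g a\<bar>\<^sup>2"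
  let ?S = "{g \<in> extensional A. bij_betw g A B}"
  have imp: "g = h" if g: "is_arg_min ?c (\<lambda>g. g \<in> ?S) g" for g
  proof -
    have gS: "g \<in> extensional A" "bij_betw g A B"
      and least: "\<And>g'. g' \<in> ?S \<Longrightarrow> \<not> ?c g' < ?c g"
      using g by (auto simp: is_arg_min_def)
    have "strict_mono_on A g"
    proof (rule strict_mono_onI, rule ccontr)
      fix a b assume ab: "a \<in> A" "b \<in> A" "a < b" "\<not> g a < g b"
      moreover have "g a \<noteq> g b"
        using ab gS(2) by (auto simp: bij_betw_def dest: inj_onD)
      ultimately have lower: "?c (g(a := g b, b := g a)) < ?c g"
        using swap_lowers_cost[of A a b g] \<open>finite A\<close> by linarith
      have "bij_betw (g(a := g b, b := g a)) A B"
        using gS(2) ab by (auto simp: bij_betw_def inj_on_def)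
      moreover have "g(a := g b, b := g a) \<in> extensional A"
        using gS(1) ab by (auto simp: extensional_def)
      ultimately show False using least lower by blast
    qed
    then show "g = h"
      using strict_mono_bij_unique[OF \<open>finite A\<close> _ gS(2) h(1,2)] gS(1) h(3)
      by (intro extensionalityI[of g A h]) auto
  qed
  have "finite B" using assms bij_betw_finite by blast
  then have "finite (A \<rightarrow>\<^sub>E B)" using \<open>finite A\<close> by (intro finite_PiE) auto
  moreover have "?S \<subseteq> (A \<rightarrow>\<^sub>E B)" by (auto simp: bij_betw_def PiE_def)
  ultimately have "finite ?S" by (rule rev_finite_subset)
  moreover have "?S \<noteq> {}" using h by blast
  ultimately obtain g0 where "is_arg_min ?c (\<lambda>g. g \<in> ?S) g0"
    using ex_is_arg_min_if_finite[of ?S ?c] by blast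
  with imp show ?thesis by blast
qed

section \<open>The center-outward distribution function of a symmetrized sample\<close>

text \<open>Generic samples are those whose symmetrization consists of \<open>2 n\<close> distinct points.\<close>

definition generic_sample :: "nat \<Rightarrow> (nat \<Rightarrow> real) \<Rightarrow> bool" where
  "generic_sample n x \<longleftrightarrow> (\<forall>i\<in>{1..n}. x i \<noteq> 0) \<and> inj_on (\<lambda>i. \<bar>x i\<bar>) {1..n}"

definition signed_rank :: "nat \<Rightarrow> (nat \<Rightarrow> real) \<Rightarrow> real \<Rightarrow> real" where
  "signed_rank n x = (\<lambda>y\<in>symmetrized n x.
     sgn y * real (card {j\<in>{1..n}. \<bar>x j\<bar> \<le> \<bar>y\<bar>}) / (real n + 1))"

lemma finite_symmetrized: "finite (symmetrized n x)"
  by (simp add: symmetrized_def)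

lemma generic_sample_symmetrized:
  assumes "generic_sample n x"
  shows "inj_on x {1..n}" "inj_on (\<lambda>i. - x i) {1..n}"
    and "x ` {1..n} \<inter> (\<lambda>i. - x i) ` {1..n} = {}"
proof -
  have nz: "x i \<noteq> 0" if "i \<in> {1..n}" for i
    using assms that by (auto simp: generic_sample_def)
  have eq: "i = j" if "i \<in> {1..n}" "j \<in> {1..n}" "\<bar>x i\<bar> = \<bar>x j\<bar>" for i j
    using assms that unfolding generic_sample_def by (metis inj_onD)
  show "inj_on x {1..n}" "inj_on (\<lambda>i. - x i) {1..n}"
    using eq by (auto intro!: inj_onI)
  have False if "i \<in> {1..n}" "j \<in> {1..n}" "x i = - x j" for i j
    using eq[of i j] nz[of i] that by auto
  then show "x ` {1..n} \<inter> (\<lambda>i. - x i) ` {1..n} = {}"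
    by blast
qed

lemma assignment_cost_eq:
  assumes "generic_sample n x"
  shows "assignment_cost n x g = (\<Sum>y\<in>symmetrized n x. \<bar>y - g y\<bar>\<^sup>2)"
  unfolding symmetrized_def assignment_cost_def
  using generic_sample_symmetrized[OF assms]
  by (subst sum.union_disjoint) (auto simp: sum.reindex)

lemma bij_betw_abs_rank:
  assumes "generic_sample n x"
  shows "bij_betw (abs_rank n x) {1..n} {1..n}"
proof -
  have lt: "abs_rank n x i < abs_rank n x j" if "j \<in> {1..n}" "\<bar>x i\<bar> < \<bar>x j\<bar>" for i j
    unfolding abs_rank_def using that by (intro card_filter_le_strict_mono) auto
  have "inj_on (abs_rank n x) {1..n}"
  proof (rule inj_onI)
    fix i j assume ij: "i \<in> {1..n}" "j \<in> {1..n}" "abs_rank n x i = abs_rank n x j"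
    then have "\<bar>x i\<bar> = \<bar>x j\<bar>" using lt[of i j] lt[of j i] by linarith
    then show "i = j" using assms ij unfolding generic_sample_def by (metis inj_onD)
  qed
  moreover have "abs_rank n x ` {1..n} \<subseteq> {1..n}"
  proof
    fix r assume "r \<in> abs_rank n x ` {1..n}"
    then obtain i where i: "i \<in> {1..n}" "r = abs_rank n x i" by blast
    have "0 < abs_rank n x i" unfolding abs_rank_def using i by (auto simp: card_gt_0_iff)
    moreover have "abs_rank n x i \<le> card {1..n}" unfolding abs_rank_def
      by (intro card_mono) auto
    ultimately show "r \<in> {1..n}" using i by simp
  qed
  ultimately show ?thesis
    by (simp add: bij_betw_def endo_inj_surj)
qed

lemma signed_rank_sample:
  assumes "i \<in> {1..n}"
  shows "signed_rank n x (x i) = sgn (x i) * real (abs_rank n x i) / (real n + 1)"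
    and "signed_rank n x (- x i) = - (sgn (x i) * real (abs_rank n x i) / (real n + 1))"
  using assms by (auto simp: signed_rank_def symmetrized_def abs_rank_def sgn_minus)

lemma symmetrized_cases:
  assumes "y \<in> symmetrized n x"
  obtains i where "i \<in> {1..n}" "y = x i" | i where "i \<in> {1..n}" "y = - x i"
  using assms unfolding symmetrized_def by blast

lemma strict_mono_on_signed_rank:
  assumes "generic_sample n x"
  shows "strict_mono_on (symmetrized n x) (signed_rank n x)"
proof (rule strict_mono_onI)
  define c where "c y = real (card {j\<in>{1..n}. \<bar>x j\<bar> \<le> \<bar>y\<bar>})" for y
  have obt: "\<exists>i\<in>{1..n}. \<bar>x i\<bar> = \<bar>y\<bar>" "y \<noteq> 0" if "y \<in> symmetrized n x" for y
    using assms that by (auto simp: generic_sample_def elim!: symmetrized_cases)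
  have pos: "c y > 0" if "y \<in> symmetrized n x" for y
    using obt(1)[OF that] unfolding c_def by (force simp: card_gt_0_iff)
  have lt: "c y < c z" if "\<bar>y\<bar> < \<bar>z\<bar>" and z: "z \<in> symmetrized n x" for y z
  proof -
    obtain i where "i \<in> {1..n}" "\<bar>x i\<bar> = \<bar>z\<bar>" using obt(1)[OF z] by blast
    then show ?thesis
      using card_filter_le_strict_mono[of "{1..n}" i "\<bar>y\<bar>" "\<lambda>j. \<bar>x j\<bar>"] that
      by (simp add: c_def)
  qed
  fix y z assume yz: "y \<in> symmetrized n x" "z \<in> symmetrized n x" "y < z"
  have "sgn y * c y < sgn z * c z"
    using obt(2)[OF yz(1)] obt(2)[OF yz(2)] pos[OF yz(1)] pos[OF yz(2)]
      lt[of y z] lt[of z y] yz by (auto simp: sgn_real_def split: if_splits)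
  then show "signed_rank n x y < signed_rank n x z"
    using yz by (simp add: signed_rank_def c_def divide_strict_right_mono)
qed

text \<open>Surjectivity comes from counting: the symmetrized sample has \<open>2 n\<close> points and the grid has
  at most \<open>2 n\<close>.\<close>

lemma bij_betw_signed_rank:
  assumes "generic_sample n x"
  shows "bij_betw (signed_rank n x) (symmetrized n x) (grid n)"
proof -
  have inj: "inj_on (signed_rank n x) (symmetrized n x)"
    using strict_mono_on_signed_rank[OF assms] by (rule strict_mono_on_imp_inj_on)
  have sub: "signed_rank n x ` symmetrized n x \<subseteq> grid n"
  proof
    fix v assume "v \<in> signed_rank n x ` symmetrized n x"
    then obtain y where y: "y \<in> symmetrized n x" "v = signed_rank n x y" by blast
    from y(1) obtain i where i: "i \<in> {1..n}" "y = x i \<or> y = - x i"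
      by (auto elim: symmetrized_cases)
    define r where "r = abs_rank n x i"
    have r: "r \<in> {1..n}"
      using bij_betw_abs_rank[OF assms] i(1) unfolding r_def by (auto simp: bij_betw_def)
    have "x i \<noteq> 0" using assms i(1) by (auto simp: generic_sample_def)
    then have "v = real r / (real n + 1) \<or> v = - (real r / (real n + 1))"
      using signed_rank_sample[OF i(1), of x] i(2) y(2) unfolding r_def
      by (auto simp: sgn_real_def split: if_splits)
    then show "v \<in> grid n" using r by (auto simp: grid_def)
  qed
  have "card (grid n) \<le> card {1..n} + card {1..n}"
    unfolding grid_def
    by (rule order_trans[OF card_Un_le]) (intro add_mono card_image_le, auto)
  also have "\<dots> = card (symmetrized n x)"
    using generic_sample_symmetrized[OF assms] unfolding symmetrized_def
    by (simp add: card_Un_disjoint card_image)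
  also have "\<dots> = card (signed_rank n x ` symmetrized n x)"
    using inj by (simp add: card_image)
  finally have "card (grid n) \<le> card (signed_rank n x ` symmetrized n x)" .
  moreover have "finite (grid n)" by (simp add: grid_def)
  ultimately have "signed_rank n x ` symmetrized n x = grid n"
    using sub by (intro card_seteq) auto
  with inj show ?thesis by (simp add: bij_betw_def)
qed

lemma center_outward_eq_signed_rank:
  assumes "generic_sample n x"
  shows "center_outward n x = signed_rank n x"
proof -
  have "signed_rank n x \<in> extensional (symmetrized n x)"
    by (simp add: signed_rank_def)
  moreover have "assignment_cost n x = (\<lambda>g. \<Sum>y\<in>symmetrized n x. \<bar>y - g y\<bar>\<^sup>2)"
    using assignment_cost_eq[OF assms] by auto
  ultimately have "is_arg_min (assignment_cost n x) (\<lambda>g. g \<in> assignments n x) g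
      \<longleftrightarrow> g = signed_rank n x" for g
    unfolding assignments_def
    using is_arg_min_squared_distance_iff[OF finite_symmetrized
        strict_mono_on_signed_rank[OF assms] bij_betw_signed_rank[OF assms]]
    by simp
  then show ?thesis by (simp add: center_outward_def)
qed

section \<open>The two identities for generic samples\<close>

lemma sum_sgn_weighted:
  fixes x w :: "nat \<Rightarrow> real"
  assumes "finite I" "\<And>i. i \<in> I \<Longrightarrow> x i \<noteq> 0"
  shows "(\<Sum>i\<in>I. sgn (x i) * w i) = 2 * (\<Sum>i | i \<in> I \<and> x i > 0. w i) - (\<Sum>i\<in>I. w i)"
proof -
  have "(\<Sum>i | i \<in> I \<and> x i > 0. w i) = (\<Sum>i\<in>I. if x i > 0 then w i else 0)"
    using assms(1) by (rule sum.inter_filter)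
  moreover have "(\<Sum>i\<in>I. sgn (x i) * w i) = (\<Sum>i\<in>I. 2 * (if x i > 0 then w i else 0) - w i)"
    using assms(2) by (intro sum.cong) (auto simp: sgn_real_def)
  ultimately show ?thesis by (simp add: sum_subtractf sum_distrib_left)
qed

lemma T_S_generic:
  assumes "n \<ge> 1" and gen: "generic_sample n x"
  shows "sqrt (real n) * T_S n x = 2 * W_sign n x - real n"
proof -
  have "center_outward_sign n x (x i) = sgn (x i) * 1" if "i \<in> {1..n}" for i
  proof -
    have "abs_rank n x i \<in> {1..n}"
      using bij_betw_abs_rank[OF gen] that by (auto simp: bij_betw_def)
    moreover have "x i \<noteq> 0" using gen that by (auto simp: generic_sample_def)
    ultimately show ?thesis
      using that by (auto simp: center_outward_sign_def center_outward_eq_signed_rank[OF gen]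
          signed_rank_sample sgn_real_def)
  qed
  then have "sqrt (real n) * T_S n x = (\<Sum>i=1..n. sgn (x i) * 1)"
    using \<open>n \<ge> 1\<close> by (simp add: T_S_def)
  also have "\<dots> = 2 * (\<Sum>i | i \<in> {1..n} \<and> x i > 0. 1) - (\<Sum>i=1..n. 1)"
    using gen by (intro sum_sgn_weighted) (auto simp: generic_sample_def)
  also have "(\<Sum>i | i \<in> {1..n} \<and> x i > 0. 1) = W_sign n x"
    unfolding W_sign_def by (subst sum.inter_filter) (auto intro: sum.cong)
  finally show ?thesis by simp
qed

lemma T_F_generic:
  assumes "n \<ge> 1" and gen: "generic_sample n x"
  shows "sqrt (real n) * T_F n x =
    (2 * W_Wilcoxon n x - real n * (real n + 1) / 2) / (real n + 1)"
proof -
  have "sqrt (real n) * T_F n x = (\<Sum>i=1..n. signed_rank n x (x i))"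
    using \<open>n \<ge> 1\<close> by (simp add: T_F_def center_outward_eq_signed_rank[OF gen])
  also have "\<dots> = (\<Sum>i=1..n. sgn (x i) * real (abs_rank n x i)) / (real n + 1)"
    by (simp add: signed_rank_sample sum_divide_distrib)
  also have "(\<Sum>i=1..n. sgn (x i) * real (abs_rank n x i))
      = 2 * W_Wilcoxon n x - (\<Sum>i=1..n. real (abs_rank n x i))"
    unfolding W_Wilcoxon_def
    using gen by (intro sum_sgn_weighted) (auto simp: generic_sample_def)
  also have "(\<Sum>i=1..n. real (abs_rank n x i)) = (\<Sum>k=1..n. real k)"
    using bij_betw_abs_rank[OF gen] by (rule sum.reindex_bij_betw)
  also have "\<dots> = real n * (real n + 1) / 2"
    by (induction n) (auto simp: field_simps)
  finally show ?thesis .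
qed

section \<open>Samples from a continuous distribution are generic\<close>

text \<open>For each value \<open>y\<close> of \<open>Y\<close> the event \<open>\<bar>Z\<bar> = \<bar>y\<bar>\<close> confines \<open>Z\<close> to at most two points, hence
  is null; Fubini on the product of the two distributions makes the union over \<open>y\<close> null.\<close>

lemma AE_abs_neq_of_indep:
  fixes Y Z :: "'a \<Rightarrow> real"
  assumes "prob_space M" and indep: "prob_space.indep_var M borel Y borel Z"
    and atomless: "\<And>z. emeasure (distr M borel Z) {z} = 0"
  shows "AE \<omega> in M. \<bar>Y \<omega>\<bar> \<noteq> \<bar>Z \<omega>\<bar>"
proof -
  interpret prob_space M by fact
  have [measurable]: "Y \<in> borel_measurable M" "Z \<in> borel_measurable M"
    using indep indep_var_rv1 indep_var_rv2 by auto
  interpret DY: prob_space "distr M borel Y" by (rule prob_space_distr) simp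
  interpret DZ: prob_space "distr M borel Z" by (rule prob_space_distr) simp
  interpret P: pair_sigma_finite "distr M borel Y" "distr M borel Z" ..
  have "AE z in distr M borel Z. \<bar>y\<bar> \<noteq> \<bar>z\<bar>" for y :: real
  proof -
    have "{y} \<union> {- y} \<in> null_sets (distr M borel Z)"
      using atomless by (intro null_sets.Un null_setsI) auto
    from AE_not_in[OF this] show ?thesis by eventually_elim (auto simp: abs_if split: if_splits)
  qed
  moreover have "Measurable.pred (borel \<Otimes>\<^sub>M borel) (\<lambda>p :: real \<times> real. \<bar>fst p\<bar> \<noteq> \<bar>snd p\<bar>)"
    by measurable
  ultimately have "AE p in distr M borel Y \<Otimes>\<^sub>M distr M borel Z. \<bar>fst p\<bar> \<noteq> \<bar>snd p\<bar>"
    by (intro P.AE_pair_measure) (simp_all add: pred_def space_pair_measure)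
  then have "AE p in distr M (borel \<Otimes>\<^sub>M borel) (\<lambda>\<omega>. (Y \<omega>, Z \<omega>)). \<bar>fst p\<bar> \<noteq> \<bar>snd p\<bar>"
    using indep unfolding indep_var_distribution_eq by metis
  then show ?thesis by (subst (asm) AE_distr_iff) auto
qed

lemma AE_generic:
  assumes "continuous_random_sample M n X"
  shows "AE \<omega> in M. generic_sample n (\<lambda>i. X i \<omega>)"
proof -
  interpret prob_space M using assms by (simp add: continuous_random_sample_def)
  have indep: "indep_vars (\<lambda>_. borel) X {1..n}"
    using assms by (simp add: continuous_random_sample_def)
  obtain D where D: "\<And>i. i \<in> {1..n} \<Longrightarrow> distr M borel (X i) = D" "continuous_on UNIV (cdf D)"
    using assms by (auto simp: continuous_random_sample_def)
  have rv: "X i \<in> borel_measurable M" if "i \<in> {1..n}" for i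
    using indep that by (auto simp: indep_vars_def)
  have atomless: "emeasure (distr M borel (X i)) {z} = 0" if i: "i \<in> {1..n}" for i z
  proof -
    interpret DX: real_distribution "distr M borel (X i)"
      using rv[OF i] by (rule real_distribution_distr)
    have "isCont (cdf (distr M borel (X i))) z"
      using D(1)[OF i] D(2) by (simp add: continuous_on_eq_continuous_at)
    then show ?thesis by (simp add: DX.isCont_cdf DX.emeasure_eq_measure)
  qed
  have nz: "AE \<omega> in M. X i \<omega> \<noteq> 0" if i: "i \<in> {1..n}" for i
  proof -
    have "{0} \<in> null_sets (distr M borel (X i))"
      using atomless[OF i] by (intro null_setsI) auto
    from AE_not_in[OF this] show ?thesis
      using rv[OF i] by (subst (asm) AE_distr_iff) auto
  qed
  have neq: "AE \<omega> in M. i \<noteq> j \<longrightarrow> \<bar>X i \<omega>\<bar> \<noteq> \<bar>X j \<omega>\<bar>" if ij: "i \<in> {1..n}" "j \<in> {1..n}" for i j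
  proof (cases "i = j")
    case False
    have "indep_var borel (X i) borel (X j)"
      using indep_vars_sum[of "{j}" i X] indep_vars_subset[OF indep, of "{i, j}"] ij False
      by simp
    then show ?thesis using atomless ij by (auto intro: AE_abs_neq_of_indep prob_space_axioms)
  qed simp
  have "AE \<omega> in M. \<forall>i\<in>{1..n}. X i \<omega> \<noteq> 0"
    using nz by (intro AE_finite_allI) auto
  moreover have "AE \<omega> in M. \<forall>i\<in>{1..n}. \<forall>j\<in>{1..n}. i \<noteq> j \<longrightarrow> \<bar>X i \<omega>\<bar> \<noteq> \<bar>X j \<omega>\<bar>"
    using neq by (intro AE_finite_allI) auto
  ultimately show ?thesis
    by eventually_elim (auto simp: generic_sample_def inj_on_def)
qed

section \<open>The tests\<close>

lemma equivalent_test_statisticsI: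
  fixes T W :: "(nat \<Rightarrow> real) \<Rightarrow> real"
  assumes "a > 0" and "\<And>x. generic_sample n x \<Longrightarrow> T x = a * W x + b"
  shows "equivalent_test_statistics TYPE('a) n T W"
  unfolding equivalent_test_statistics_def
proof (intro exI[of _ "\<lambda>t. a * t + b"] conjI allI impI)
  show "increasing_affine (\<lambda>t. a * t + b)"
    using \<open>a > 0\<close> by (auto simp: increasing_affine_def strict_mono_def)
  fix M :: "'a measure" and X
  assume "continuous_random_sample M n X"
  from AE_generic[OF this] show "AE \<omega> in M. T (\<lambda>i. X i \<omega>) = a * W (\<lambda>i. X i \<omega>) + b"
    by eventually_elim (rule assms(2))
qed

theorem mainTheorem7:
  fixes M :: "'a measure" and X :: "nat \<Rightarrow> 'a \<Rightarrow> real" and n :: nat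
  assumes "n \<ge> 1"
    and "continuous_random_sample M n X"
  shows "(AE \<omega> in M.
      sqrt (real n) * T_S n (\<lambda>i. X i \<omega>) = 2 * W_sign n (\<lambda>i. X i \<omega>) - real n \<and>
      sqrt (real n) * T_F n (\<lambda>i. X i \<omega>) =
        (2 * W_Wilcoxon n (\<lambda>i. X i \<omega>) - real n * (real n + 1) / 2) / (real n + 1)) \<and>
    equivalent_test_statistics TYPE('a) n (T_S n) (W_sign n) \<and>
    equivalent_test_statistics TYPE('a) n (T_F n) (W_Wilcoxon n)"
proof (intro conjI)
  show "AE \<omega> in M.
      sqrt (real n) * T_S n (\<lambda>i. X i \<omega>) = 2 * W_sign n (\<lambda>i. X i \<omega>) - real n \<and>
      sqrt (real n) * T_F n (\<lambda>i. X i \<omega>) =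
        (2 * W_Wilcoxon n (\<lambda>i. X i \<omega>) - real n * (real n + 1) / 2) / (real n + 1)"
    using AE_generic[OF assms(2)]
    by eventually_elim (use T_S_generic T_F_generic assms(1) in blast)
  have s: "sqrt (real n) > 0" using assms(1) by simp
  show "equivalent_test_statistics TYPE('a) n (T_S n) (W_sign n)"
  proof (rule equivalent_test_statisticsI)
    show "0 < 2 / sqrt (real n)" using s by simp
    show "T_S n x = 2 / sqrt (real n) * W_sign n x + - real n / sqrt (real n)"
      if "generic_sample n x" for x
      using T_S_generic[OF assms(1) that] s
      by (simp add: divide_simps) (simp add: algebra_simps)
  qed
  show "equivalent_test_statistics TYPE('a) n (T_F n) (W_Wilcoxon n)"
  proof (rule equivalent_test_statisticsI)
    show "0 < 2 / ((real n + 1) * sqrt (real n))" using s by simp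
    show "T_F n x = 2 / ((real n + 1) * sqrt (real n)) * W_Wilcoxon n x
        + - (real n / 2) / sqrt (real n)"
      if "generic_sample n x" for x
    proof -
      have "T_F n x = (sqrt (real n) * T_F n x) / sqrt (real n)" using s by simp
      also have "\<dots> = (2 / (real n + 1) * W_Wilcoxon n x - real n / 2) / sqrt (real n)"
        unfolding T_F_generic[OF assms(1) that] by (simp add: field_simps)
      finally show ?thesis by (simp add: diff_divide_distrib)
    qed
  qed
qed

end
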